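(* Let $n\ge1$, let $g\in\ell^2(\mathbb{Z}^n)$ be a non-zero window function and let $\Sigma\subset\mathbb{Z}^n\times\mathbb{T}^n$ be measurable. If the operator norm satisfies $\|P_\Sigma P_g\|<1$, then there exists a constant $c(\Sigma,g)>0$ such that for every $f\in\ell^2(\mathbb{Z}^n)$, $$\|f\|_{\ell^2(\mathbb{Z}^n)}\,\|g\|_{\ell^2(\mathbb{Z}^n)}\le c(\Sigma,g)\,\left\|\chi_{\Sigma^c}V_gf\right\|_{L^2(\mathbb{Z}^n\times\mathbb{T}^n)}.$$
   Context: For $f,g\in\ell^2(\mathbb{Z}^n)$ the short-time Fourier transform (STFT) of $f$ with window $g$ is the function on $\mathbb{Z}^n\times\mathbb{T}^n$ (where $\mathbb{T}^n=\mathbb{R}^n/\mathbb{Z}^n$) given by $V_gf(m,w)=\sum_{k\in\mathbb{Z}^n}f(k)\,\overline{g(k-m)}\,e^{-2\pi i w\cdot k}$. $L^2(\mathbb{Z}^n\times\mathbb{T}^n)$ is taken with respect to the product of counting measure on $\mathbb{Z}^n$ and Lebesgue measure on $\mathbb{T}^n$ (total mass $1$). $P_g$ is the orthogonal projection of $L^2(\mathbb{Z}^n\times\mathbb{T}^n)$ onto the closed subspace $V_g(\ell^2(\mathbb{Z}^n))=\{V_gf:f\in\ell^2(\mathbb{Z}^n)\}$, and $P_\Sigma$ is the orthogonal projection $P_\Sigma F=\chi_\Sigma F$ on $L^2(\mathbb{Z}^n\times\mathbb{T}^n)$, where $\chi_\Sigma$ is the characteristic function of $\Sigma$. $\Sigma^c$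 is the complement of $\Sigma$. *)

theory Defs
  imports "HOL-Analysis.Analysis"
begin

section \<open>The torus\<close>

definition int_translates :: "real ^ 'n \<Rightarrow> real ^ 'n \<Rightarrow> bool" where
  "int_translates x y \<longleftrightarrow> (\<forall>i. x $ i - y $ i \<in> \<int>)"

quotient_type 'n torus = "real ^ ('n :: finite)" / int_translates
  morphisms rep_torus to_torus
proof (rule equivpI)
  show "reflp int_translates"
    by (simp add: reflp_def int_translates_def)
  show "symp int_translates"
    unfolding symp_def int_translates_def by (metis Ints_minus minus_diff_eq)
  show "transp int_translates"
    unfolding transp_def int_translates_def
    by (metis Ints_add diff_add_cancel add_diff_eq)
qed

text \<open>Lebesgue measure on the torus: a set is measurable iff its preimage in Euclidean space is
  Lebesgue measurable, and its measure is that of the part of the preimage in the unit cube.\<close>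

definition torus_lebesgue :: "('n :: finite) torus measure" where
  "torus_lebesgue =
     distr (restrict_space lebesgue {x :: real ^ 'n. \<forall>i. 0 \<le> x $ i \<and> x $ i < 1})
           (sigma UNIV {A. to_torus -` A \<in> sets (lebesgue :: (real ^ 'n) measure)})
           to_torus"

lift_definition torus_char :: "int ^ 'n \<Rightarrow> ('n :: finite) torus \<Rightarrow> complex"
  is "\<lambda>k w. exp (- 2 * of_real pi * \<i> * of_real (\<Sum>j\<in>UNIV. w $ j * of_int (k $ j)))"
proof -
  fix k :: "int ^ 'n" and w w' :: "real ^ 'n"
  assume "int_translates w w'"
  hence "(\<Sum>j\<in>UNIV. (w $ j - w' $ j) * of_int (k $ j)) \<in> \<int>"
    unfolding int_translates_def by (intro Ints_sum Ints_mult) auto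
  hence "(\<Sum>j\<in>UNIV. w $ j * of_int (k $ j)) - (\<Sum>j\<in>UNIV. w' $ j * of_int (k $ j)) \<in> \<int>"
    by (simp add: left_diff_distrib sum_subtractf)
  then obtain N where "(\<Sum>j\<in>UNIV. w $ j * of_int (k $ j)) =
      (\<Sum>j\<in>UNIV. w' $ j * of_int (k $ j)) + real_of_int N"
    by (metis Ints_cases add.commute diff_add_cancel)
  hence *: "- 2 * of_real pi * \<i> * complex_of_real (\<Sum>j\<in>UNIV. w $ j * of_int (k $ j)) =
      - 2 * of_real pi * \<i> * complex_of_real (\<Sum>j\<in>UNIV. w' $ j * of_int (k $ j))
      + of_real (of_int (2 * (- N)) * pi) * \<i>"
    by (simp only: of_real_add) (simp add: algebra_simps)
  show "exp (- 2 * of_real pi * \<i> * complex_of_real (\<Sum>j\<in>UNIV. w $ j * of_int (k $ j))) =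
      exp (- 2 * of_real pi * \<i> * complex_of_real (\<Sum>j\<in>UNIV. w' $ j * of_int (k $ j)))"
    unfolding exp_eq by (rule exI, rule *)
qed


section \<open>The spaces of square-summable and square-integrable functions\<close>

definition ell2 :: "('a \<Rightarrow> complex) set" where
  "ell2 = {f. (\<lambda>k. (cmod (f k))\<^sup>2) summable_on UNIV}"

definition ell2_norm :: "('a \<Rightarrow> complex) \<Rightarrow> real" where
  "ell2_norm f = sqrt (\<Sum>\<^sub>\<infinity>k. (cmod (f k))\<^sup>2)"

text \<open>Elements of $L^2$ are represented by functions; two of them are identified when they agree
  almost everywhere.\<close>

definition Lsq :: "'a measure \<Rightarrow> ('a \<Rightarrow> complex) set" where
  "Lsq M = {F \<in> borel_measurable M. integrable M (\<lambda>x. (cmod (F x))\<^sup>2)}"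

definition Lsq_norm :: "'a measure \<Rightarrow> ('a \<Rightarrow> complex) \<Rightarrow> real" where
  "Lsq_norm M F = sqrt (LINT x|M. (cmod (F x))\<^sup>2)"

definition Lsq_inner :: "'a measure \<Rightarrow> ('a \<Rightarrow> complex) \<Rightarrow> ('a \<Rightarrow> complex) \<Rightarrow> complex" where
  "Lsq_inner M F G = (LINT x|M. F x * cnj (G x))"

text \<open>The operator norm is a supremum in the extended nonnegative reals, so that an unbounded
  operator has norm \<open>\<infinity>\<close>.\<close>

definition Lsq_opnorm ::
    "'a measure \<Rightarrow> (('a \<Rightarrow> complex) \<Rightarrow> ('a \<Rightarrow> complex)) \<Rightarrow> ennreal" where
  "Lsq_opnorm M T = (SUP F \<in> {F \<in> Lsq M. Lsq_norm M F \<le> 1}. ennreal (Lsq_norm M (T F)))"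

text \<open>The orthogonal projection onto a closed subspace \<open>S\<close> of $L^2$: the element of \<open>S\<close> whose
  difference from \<open>F\<close> is orthogonal to \<open>S\<close>. It is unique up to equality almost everywhere,
  and the choice operator picks a representative.\<close>

definition orth_proj ::
    "'a measure \<Rightarrow> ('a \<Rightarrow> complex) set \<Rightarrow> ('a \<Rightarrow> complex) \<Rightarrow> ('a \<Rightarrow> complex)" where
  "orth_proj M S F = (SOME H. H \<in> S \<and> (\<forall>G\<in>S. Lsq_inner M (\<lambda>x. F x - H x) G = 0))"

definition restrict_op :: "'a set \<Rightarrow> ('a \<Rightarrow> complex) \<Rightarrow> ('a \<Rightarrow> complex)" where
  "restrict_op S F = (\<lambda>x. indicator S x * F x)"


section \<open>The short-time Fourier transform\<close>

definition phase_measure :: "((int ^ 'n) \<times> ('n :: finite) torus) measure" where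
  "phase_measure = count_space UNIV \<Otimes>\<^sub>M torus_lebesgue"

definition stft ::
    "(int ^ 'n \<Rightarrow> complex) \<Rightarrow> (int ^ 'n \<Rightarrow> complex) \<Rightarrow> (int ^ 'n) \<times> ('n :: finite) torus \<Rightarrow> complex"
where
  "stft g f = (\<lambda>(m, w). \<Sum>\<^sub>\<infinity>k. f k * cnj (g (k - m)) * torus_char k w)"

definition stft_proj ::
    "(int ^ 'n \<Rightarrow> complex) \<Rightarrow> ((int ^ 'n) \<times> ('n :: finite) torus \<Rightarrow> complex)
       \<Rightarrow> ((int ^ 'n) \<times> 'n torus \<Rightarrow> complex)" where
  "stft_proj g = orth_proj phase_measure (stft g ` ell2)"

end

theory Submission
  imports Defs
begin

text \<open>By orthonormality of the characters, Parseval's identity in each fibre $\{m\} \times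
  \mathbb{T}^n$ followed by summation over $m$ gives $\|V_g f\| = \|f\| \|g\|$, so that $V_g$ is
  injective and $P_g$ fixes $V_g f$. With $r = \|P_\Sigma P_g\| < 1$ the identity
  $\|\chi_{\Sigma} V_g f\|^2 + \|\chi_{\Sigma^c} V_g f\|^2 = \|V_g f\|^2$ then yields the
  constant $(1 - r^2)^{-1/2}$.\<close>

section \<open>Countable sums of integrals\<close>

text \<open>Absolute summability turns an unordered sum into an integral against counting measure,
  so that Fubini's theorem can exchange sums and integrals below.\<close>

lemma infsum_eq_LINT_count_space:
  fixes f :: "'k \<Rightarrow> complex"
  assumes "(\<lambda>k. norm (f k)) summable_on UNIV"
  shows "infsum f UNIV = (LINT k|count_space UNIV. f k)"
  using assms by (metis abs_summable_equivalent infsetsum_infsum infsetsum_def)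

lemma nn_integral_count_space_eq_infsum:
  fixes f :: "'k \<Rightarrow> real"
  assumes "f summable_on UNIV" "\<And>k. 0 \<le> f k"
  shows "(\<integral>\<^sup>+k. ennreal (f k) \<partial>count_space UNIV) = ennreal (infsum f UNIV)"
proof -
  have "(\<lambda>k. norm (f k)) summable_on UNIV"
    using assms by simp
  hence "Infinite_Set_Sum.abs_summable_on f UNIV"
    using abs_summable_equivalent by blast
  thus ?thesis
    using nn_integral_conv_infsetsum[of f UNIV] assms(2) by (simp add: infsetsum_infsum)
qed

text \<open>This is Fubini for counting measure times \<open>M\<close>. Integrability on the product
  follows from the dominating series: each term has L1 norm at most \<open>c k\<close> times the
  total mass of \<open>M\<close>, and \<open>c\<close> is summable.\<close>

lemma
  fixes f :: "'k :: countable \<Rightarrow> 'a \<Rightarrow> complex"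
  assumes "finite_measure M"
    and f [measurable]: "\<And>k. f k \<in> borel_measurable M"
    and c: "c summable_on UNIV"
    and bound: "\<And>k x. x \<in> space M \<Longrightarrow> norm (f k x) \<le> c k"
  shows borel_measurable_infsum: "(\<lambda>x. \<Sum>\<^sub>\<infinity>k. f k x) \<in> borel_measurable M"
    and LINT_infsum: "(LINT x|M. (\<Sum>\<^sub>\<infinity>k. f k x)) = (\<Sum>\<^sub>\<infinity>k. LINT x|M. f k x)"
proof -
  interpret M: finite_measure M by fact
  interpret N: sigma_finite_measure "count_space (UNIV :: 'k set)"
    by (rule sigma_finite_measure_count_space_countable) simp
  interpret P: pair_sigma_finite "count_space (UNIV :: 'k set)" M ..
  have eq: "(\<Sum>\<^sub>\<infinity>k. f k x) = (LINT k|count_space UNIV. f k x)" if "x \<in> space M" for x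
    using that by (intro infsum_eq_LINT_count_space Infinite_Sum.abs_summable_on_comparison_test'[OF c] bound)
  \<comment> \<open>Since the index type is countable, measurability of each slice
    \<open>f k\<close> already gives joint measurability.\<close>
  have meas: "case_prod f \<in> borel_measurable (count_space UNIV \<Otimes>\<^sub>M M)"
    by (rule measurable_pair_measure_countable1) auto
  have meas': "(\<lambda>(x, k). f k x) \<in> borel_measurable (M \<Otimes>\<^sub>M count_space UNIV)"
    using measurable_pair_swap[OF meas] by (simp add: case_prod_beta')
  have "(\<lambda>x. LINT k|count_space UNIV. f k x) \<in> borel_measurable M"
    by (rule N.borel_measurable_lebesgue_integral[OF meas'])
  thus "(\<lambda>x. \<Sum>\<^sub>\<infinity>k. f k x) \<in> borel_measurable M"
    using measurable_cong[of M, OF eq] by simp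
  have int: "integrable M (f k)" for k
    by (rule M.integrable_const_bound[of _ "c k"]) (auto simp: bound)
  have le: "(LINT x|M. norm (f k x)) \<le> c k * measure M (space M)" for k
  proof -
    have "(LINT x|M. norm (f k x)) \<le> (LINT x|M. c k)"
      using int by (intro integral_mono) (auto simp: bound)
    thus ?thesis by (simp add: mult.commute)
  qed
  have c': "(\<lambda>k. c k * measure M (space M)) summable_on UNIV"
    using c by (rule summable_on_cmult_left)
  have sum_norm: "(\<lambda>k. norm (LINT x|M. norm (f k x))) summable_on UNIV"
    using le by (intro Infinite_Sum.abs_summable_on_comparison_test'[OF c']) simp
  have "integrable (count_space UNIV) (\<lambda>k. LINT x|M. norm (f k x))"
    using sum_norm abs_summable_equivalent abs_summable_on_def by blast
  hence "integrable (count_space UNIV \<Otimes>\<^sub>M M) (case_prod f)"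
    using meas int by (intro P.Fubini_integrable) auto
  hence "(LINT x|M. LINT k|count_space UNIV. f k x) = (LINT k|count_space UNIV. LINT x|M. f k x)"
    by (rule P.Fubini_integral)
  moreover have "(\<Sum>\<^sub>\<infinity>k. LINT x|M. f k x) = (LINT k|count_space UNIV. LINT x|M. f k x)"
    by (intro infsum_eq_LINT_count_space Infinite_Sum.abs_summable_on_comparison_test'[OF c'])
      (rule order_trans[OF integral_norm_bound le])
  moreover have "(LINT x|M. (\<Sum>\<^sub>\<infinity>k. f k x)) = (LINT x|M. LINT k|count_space UNIV. f k x)"
    by (intro Bochner_Integration.integral_cong refl eq)
  ultimately show "(LINT x|M. (\<Sum>\<^sub>\<infinity>k. f k x)) = (\<Sum>\<^sub>\<infinity>k. LINT x|M. f k x)"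
    by simp
qed

section \<open>Parseval's identity for bounded orthonormal families\<close>

lemma borel_measurable_cnj [measurable]:
  assumes "f \<in> borel_measurable M"
  shows "(\<lambda>x. cnj (f x)) \<in> borel_measurable M"
  using assms by (rule borel_measurable_continuous_on[rotated]) (intro continuous_intros)

text \<open>Absolute summability of \<open>a\<close> together with the bound 1 on the
  \<open>e k\<close> makes the series bounded by the sum \<open>C\<close> of the norms. The
  exchanges of sum and integral are then dominated by \<open>norm (a k)\<close> and
  \<open>C * norm (a k)\<close>, and no completeness of L2 enters. Nonnegative integrals are used in
  the conclusion so that it can be fed directly into Tonelli's theorem.\<close>

lemma nn_integral_orthonormal_series:
  fixes e :: "'k :: countable \<Rightarrow> 'a \<Rightarrow> complex"
  assumes "finite_measure M"
    and e [measurable]: "\<And>k. e k \<in> borel_measurable M"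
    and e_le: "\<And>k x. x \<in> space M \<Longrightarrow> norm (e k x) \<le> 1"
    and orth: "\<And>k l. (LINT x|M. e k x * cnj (e l x)) = (if k = l then 1 else 0)"
    and a: "(\<lambda>k. norm (a k)) summable_on UNIV"
  shows "(\<integral>\<^sup>+x. ennreal ((cmod (\<Sum>\<^sub>\<infinity>k. a k * e k x))\<^sup>2) \<partial>M)
         = (\<integral>\<^sup>+k. ennreal ((cmod (a k))\<^sup>2) \<partial>count_space UNIV)"
proof -
  interpret M: finite_measure M by fact
  define S where "S x = (\<Sum>\<^sub>\<infinity>k. a k * e k x)" for x
  define C where "C = (\<Sum>\<^sub>\<infinity>k. norm (a k))"
  have ae_le: "norm (a k * e k x) \<le> norm (a k)" if "x \<in> space M" for k x
    using e_le[OF that] by (simp add: norm_mult mult_left_le)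
  have [measurable]: "S \<in> borel_measurable M"
    unfolding S_def
    by (rule borel_measurable_infsum[OF assms(1) _ a]) (auto simp: ae_le)
  have S_le: "norm (S x) \<le> C" if "x \<in> space M" for x
  proof -
    have s: "(\<lambda>k. norm (a k * e k x)) summable_on UNIV"
      using ae_le[OF that] by (intro Infinite_Sum.abs_summable_on_comparison_test'[OF a])
    have "norm (S x) \<le> (\<Sum>\<^sub>\<infinity>k. norm (a k * e k x))"
      unfolding S_def by (rule norm_infsum_bound[OF s])
    also have "\<dots> \<le> C"
      unfolding C_def using ae_le[OF that] by (intro infsum_mono s a)
    finally show ?thesis .
  qed
  \<comment> \<open>Integrating term by term against \<open>cnj (e j x)\<close>, orthonormality
    leaves only the term with index \<open>j\<close>.\<close>
  have coeff: "(LINT x|M. S x * cnj (e j x)) = a j" for j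
  proof -
    have "(LINT x|M. S x * cnj (e j x)) = (LINT x|M. (\<Sum>\<^sub>\<infinity>k. a k * (e k x * cnj (e j x))))"
      unfolding S_def by (simp add: infsum_cmult_left' flip: mult.assoc)
    also have "\<dots> = (\<Sum>\<^sub>\<infinity>k. LINT x|M. a k * (e k x * cnj (e j x)))"
    proof (rule LINT_infsum[OF assms(1) _ a])
      fix k x assume x: "x \<in> space M"
      have "norm (e k x) * norm (e j x) \<le> 1"
        using e_le[OF x] by (simp add: mult_le_one)
      thus "norm (a k * (e k x * cnj (e j x))) \<le> norm (a k)"
        by (simp add: norm_mult mult_left_le)
    qed measurable
    also have "\<dots> = (\<Sum>\<^sub>\<infinity>k. if k = j then a j else 0)"
      by (intro infsum_cong) (simp add: orth)
    also have "\<dots> = (\<Sum>\<^sub>\<infinity>k\<in>{j}. a j)"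
      by (rule infsum_cong_neutral) auto
    finally show ?thesis by simp
  qed
  have Ca: "(\<lambda>k. C * norm (a k)) summable_on UNIV"
    using a by (rule summable_on_cmult_right)
  \<comment> \<open>Each \<open>norm (a k)\<close> is at most the whole sum \<open>C\<close>, so the
    squares are dominated by \<open>C * norm (a k)\<close>.\<close>
  have sq: "(\<lambda>k. (cmod (a k))\<^sup>2) summable_on UNIV"
  proof -
    have "norm ((cmod (a k))\<^sup>2) \<le> C * norm (a k)" for k
    proof -
      have "norm (a k) \<le> C"
        unfolding C_def using finite_sum_le_infsum[OF a, of "{k}"] by simp
      thus ?thesis by (simp add: power2_eq_square mult_right_mono)
    qed
    thus ?thesis
      using Infinite_Sum.abs_summable_on_comparison_test'[OF Ca, of "\<lambda>k. (cmod (a k))\<^sup>2"] by simp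
  qed
  \<comment> \<open>Only the conjugated factor is expanded. The other \<open>S x\<close> stays as a
    bounded factor, so a single sum appears and each of its integrals is a coefficient known from
    \<open>coeff\<close>.\<close>
  have "(LINT x|M. S x * cnj (S x)) = (LINT x|M. (\<Sum>\<^sub>\<infinity>k. cnj (a k) * (S x * cnj (e k x))))"
  proof (rule Bochner_Integration.integral_cong[OF refl])
    fix x
    have "cnj (S x) = (\<Sum>\<^sub>\<infinity>k. cnj (a k * e k x))"
      unfolding S_def by (rule infsum_cnj[symmetric])
    hence "S x * cnj (S x) = (\<Sum>\<^sub>\<infinity>k. S x * cnj (a k * e k x))"
      by (simp add: infsum_cmult_right')
    thus "S x * cnj (S x) = (\<Sum>\<^sub>\<infinity>k. cnj (a k) * (S x * cnj (e k x)))"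
      by (simp add: mult_ac)
  qed
  also have "\<dots> = (\<Sum>\<^sub>\<infinity>k. LINT x|M. cnj (a k) * (S x * cnj (e k x)))"
  proof (rule LINT_infsum[OF assms(1) _ Ca])
    fix k x assume x: "x \<in> space M"
    have le: "norm (S x) * norm (e k x) \<le> C * 1"
      using e_le[OF x] S_le[OF x] order_trans[OF norm_ge_zero S_le[OF x]]
      by (intro mult_mono) auto
    thus "norm (cnj (a k) * (S x * cnj (e k x))) \<le> C * norm (a k)"
      using mult_left_mono[OF le, of "norm (a k)"] by (simp add: norm_mult mult.commute)
  qed measurable
  also have "\<dots> = (\<Sum>\<^sub>\<infinity>k. of_real ((cmod (a k))\<^sup>2))"
    by (simp add: coeff complex_norm_square mult.commute del: of_real_power)
  also have "\<dots> = of_real (\<Sum>\<^sub>\<infinity>k. (cmod (a k))\<^sup>2)"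
    by (intro infsumI has_sum_of_real has_sum_infsum sq)
  finally have "complex_of_real (LINT x|M. (cmod (S x))\<^sup>2) = of_real (\<Sum>\<^sub>\<infinity>k. (cmod (a k))\<^sup>2)"
    by (simp add: complex_norm_square flip: integral_complex_of_real of_real_power)
  hence parseval: "(LINT x|M. (cmod (S x))\<^sup>2) = (\<Sum>\<^sub>\<infinity>k. (cmod (a k))\<^sup>2)"
    by (simp only: of_real_eq_iff)
  have "integrable M (\<lambda>x. (cmod (S x))\<^sup>2)"
    by (rule M.integrable_const_bound[of _ "C\<^sup>2"]) (auto simp: S_le intro!: power_mono)
  hence "(\<integral>\<^sup>+x. ennreal ((cmod (S x))\<^sup>2) \<partial>M) = ennreal (LINT x|M. (cmod (S x))\<^sup>2)"
    by (intro nn_integral_eq_integral) auto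
  thus ?thesis
    by (simp add: parseval nn_integral_count_space_eq_infsum[OF sq] flip: S_def)
qed


section \<open>Characters of the torus\<close>

lemma space_torus_lebesgue [simp]: "space torus_lebesgue = UNIV"
  by (simp add: torus_lebesgue_def)

text \<open>Preimages commute with complements and countable unions, so the generating family is
  already a sigma-algebra and generates nothing beyond itself.\<close>

lemma sets_torus_lebesgue:
  "sets (torus_lebesgue :: 'n::finite torus measure) =
     {A. to_torus -` A \<in> sets (lebesgue :: (real ^ 'n) measure)}"
proof -
  have "sigma_algebra (UNIV :: 'n torus set) {A. to_torus -` A \<in> sets (lebesgue :: (real ^ 'n) measure)}"
    unfolding sigma_algebra_iff2
    using sets.compl_sets[of _ "lebesgue :: (real ^ 'n) measure"]
    by (auto simp: vimage_Diff vimage_Union intro!: sets.countable_UN'')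
  thus ?thesis
    by (simp add: torus_lebesgue_def sigma_algebra.sigma_sets_eq)
qed

lemma unit_cube_borel [measurable]:
  "{x :: real ^ 'n. \<forall>i. 0 \<le> x $ i \<and> x $ i < 1} \<in> sets borel"
proof -
  have "(\<lambda>x :: real ^ 'n. x $ i) \<in> borel_measurable borel" for i
    by (intro borel_measurable_continuous_onI continuous_intros)
  thus ?thesis
    by measurable
qed

lemma measurable_to_torus:
  "to_torus \<in> measurable (restrict_space lebesgue {x :: real ^ 'n. \<forall>i. 0 \<le> x $ i \<and> x $ i < 1})
     (sigma UNIV {A. to_torus -` A \<in> sets (lebesgue :: (real ^ 'n) measure)})"
proof (rule measurable_restrict_space1)
  show "to_torus \<in> measurable lebesgue (sigma UNIV {A. to_torus -` A \<in> sets (lebesgue :: (real ^ 'n) measure)})"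
    by (rule measurable_sigma_sets[OF sets_measure_of]) auto
qed

text \<open>Integration over the quotient is pulled back to the half-open unit cube. Borel
  measurability of the lift permits replacing \<open>lebesgue\<close> by \<open>lborel\<close>,
  whose product structure is used later.\<close>

lemma LINT_torus:
  fixes F :: "'n::finite torus \<Rightarrow> complex"
  assumes "(\<lambda>x. F (to_torus x)) \<in> borel_measurable borel" "F \<in> borel_measurable torus_lebesgue"
  shows "(LINT w|torus_lebesgue. F w) =
    (LINT x|lborel. indicator {x. \<forall>i. 0 \<le> x $ i \<and> x $ i < 1} x *\<^sub>R F (to_torus x))"
proof -
  let ?Q = "{x :: real ^ 'n. \<forall>i. 0 \<le> x $ i \<and> x $ i < 1}"
  have "(LINT w|torus_lebesgue. F w) = (LINT x|restrict_space lebesgue ?Q. F (to_torus x))"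
    using assms(2) unfolding torus_lebesgue_def by (intro integral_distr measurable_to_torus) simp
  also have "\<dots> = (LINT x|lebesgue. indicator ?Q x *\<^sub>R F (to_torus x))"
    by (rule integral_restrict_space) (auto intro: sets_completionI_sets)
  also have "\<dots> = (LINT x|lborel. indicator ?Q x *\<^sub>R F (to_torus x))"
    using assms(1) by (intro integral_completion) simp
  finally show ?thesis .
qed

lemma torus_char_to_torus:
  "torus_char k (to_torus x) = (\<Prod>j\<in>UNIV. exp (- 2 * of_real pi * \<i> * of_real (x $ j * of_int (k $ j))))"
  by (simp add: torus_char.abs_eq sum_distrib_left exp_sum)

lemma borel_measurable_torus_char_to_torus [measurable]:
  "(\<lambda>x. torus_char k (to_torus x)) \<in> borel_measurable borel"
  unfolding torus_char.abs_eq
  by (intro borel_measurable_continuous_onI continuous_intros)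

lemma borel_measurable_torus_char [measurable]: "torus_char k \<in> borel_measurable torus_lebesgue"
proof (rule measurableI)
  fix A :: "complex set" assume "A \<in> sets borel"
  hence "(\<lambda>x. torus_char k (to_torus x)) -` A \<inter> space lborel \<in> sets lborel"
    by (intro measurable_sets) auto
  hence "to_torus -` (torus_char k -` A) \<in> sets lebesgue"
    by (auto simp: vimage_def intro: sets_completionI_sets)
  thus "torus_char k -` A \<inter> space torus_lebesgue \<in> sets torus_lebesgue"
    by (simp add: sets_torus_lebesgue)
qed simp

section \<open>Modulus and orthonormality of the characters\<close>

lemma cmod_torus_char [simp]: "cmod (torus_char k w) = 1"
proof (transfer)
  fix k :: "int ^ 'n" and w :: "real ^ 'n"
  show "cmod (exp (- 2 * of_real pi * \<i> * of_real (\<Sum>j\<in>UNIV. w $ j * of_int (k $ j)))) = 1"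
    by (simp add: norm_exp_eq_Re del: of_real_sum)
qed

text \<open>Reduces the inner product of two characters to the integral of a single one, computed in
  \<open>LINT_torus_char\<close>.\<close>

lemma torus_char_mult_cnj: "torus_char k w * cnj (torus_char l w) = torus_char (k - l) w"
proof (transfer)
  fix k l :: "int ^ 'n" and w :: "real ^ 'n"
  define s where "s k = (\<Sum>j\<in>UNIV. w $ j * of_int (k $ j))" for k
  have "s (k - l) = s k - s l"
    by (simp add: s_def right_diff_distrib sum_subtractf)
  hence "exp (- 2 * of_real pi * \<i> * of_real (s k)) * cnj (exp (- 2 * of_real pi * \<i> * of_real (s l))) =
      exp (- 2 * of_real pi * \<i> * of_real (s (k - l)))"
    by (simp add: exp_cnj mult_exp_exp right_diff_distrib)
  thus "exp (- 2 * of_real pi * \<i> * of_real (\<Sum>j\<in>UNIV. w $ j * of_int (k $ j))) *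
      cnj (exp (- 2 * of_real pi * \<i> * of_real (\<Sum>j\<in>UNIV. w $ j * of_int (l $ j)))) =
      exp (- 2 * of_real pi * \<i> * of_real (\<Sum>j\<in>UNIV. w $ j * of_int ((k - l) $ j)))"
    by (simp only: s_def)
qed

lemma has_bochner_integral_circle_char:
  "has_bochner_integral lborel
     (\<lambda>x. indicator {0..<1} x *\<^sub>R exp (- 2 * of_real pi * \<i> * of_real (x * of_int m)))
     (if m = 0 then 1 else 0)"
proof -
  define c where "c = - 2 * of_real pi * \<i> * of_int m"
  have c_eq: "- 2 * of_real pi * \<i> * of_real (x * of_int m) = of_real x * c" for x
    by (simp add: c_def)
  \<comment> \<open>\<open>F\<close> is an antiderivative of the exponential on [0, 1]. The
    frequency \<open>m = 0\<close> is separate because then \<open>c = 0\<close> and the quotient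
    would not be an antiderivative.\<close>
  define F where "F x = (if m = 0 then of_real x else exp (of_real x * c) / c)" for x
  have c0: "c \<noteq> 0 \<longleftrightarrow> m \<noteq> 0" by (simp add: c_def)
  have deriv: "(F has_vector_derivative exp (of_real x * c)) (at x within {0..1})" for x
  proof (cases "m = 0")
    case True
    thus ?thesis unfolding F_def c_def
      by (auto intro!: derivative_eq_intros has_vector_derivative_of_real)
  next
    case False
    have "((\<lambda>z. exp (z * c) / c) has_field_derivative exp (of_real x * c)) (at (of_real x))"
      using False c0 by (auto intro!: derivative_eq_intros)
    from has_vector_derivative_real_field[OF this, of "{0..1}"]
    show ?thesis using False by (simp add: F_def[abs_def])
  qed
  have "exp c = 1"
  proof -
    have "c = of_real (2 * of_int (- m) * pi) * \<i>" by (simp add: c_def)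
    thus ?thesis using exp_integer_2pi[of "of_int (- m)"] by simp
  qed
  hence F1: "F 1 - F 0 = (if m = 0 then 1 else 0)"
    by (simp add: F_def)
  have "has_bochner_integral lborel (\<lambda>x. indicator {0..1} x *\<^sub>R exp (of_real x * c)) (F 1 - F 0)"
    by (rule has_bochner_integral_FTC_Icc) (auto intro!: deriv continuous_intros)
  \<comment> \<open>The fundamental theorem is applied on the closed interval, whereas the cube is
    half-open; the two integrands differ only at the point 1, which is null.\<close>
  moreover have "has_bochner_integral lborel (\<lambda>x. indicator {0..1} x *\<^sub>R exp (of_real x * c)) I \<longleftrightarrow>
      has_bochner_integral lborel (\<lambda>x. indicator {0..<1} x *\<^sub>R exp (of_real x * c)) I" for I
  proof (rule has_bochner_integral_cong_AE)
    show "AE x in lborel. indicator {0..1::real} x *\<^sub>R exp (of_real x * c) =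
        indicator {0..<1} x *\<^sub>R exp (of_real x * c)"
      using AE_lborel_singleton[of 1] by eventually_elim (auto simp: indicator_def)
  qed measurable
  ultimately show ?thesis
    unfolding c_eq F1 by blast
qed

lemma prod_Basis_vec:
  fixes f :: "real ^ 'n \<Rightarrow> 'a :: comm_monoid_mult"
  shows "prod f Basis = (\<Prod>j\<in>UNIV. f (axis j 1))"
proof -
  have "bij_betw (\<lambda>j. axis j (1::real)) (UNIV :: 'n set) Basis"
    by (auto simp: bij_betw_def inj_on_def Basis_vec_def axis_eq_axis)
  thus ?thesis by (rule prod.reindex_bij_betw[symmetric])
qed

text \<open>\<open>lborel\<close> on \<open>real ^ 'n\<close> is the image of a product measure
  indexed by \<open>Basis\<close>, where the integral of a product of one-variable functions
  factors.\<close>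

lemma integral_lborel_prod:
  fixes \<phi> :: "'n::finite \<Rightarrow> real \<Rightarrow> complex"
  assumes int: "\<And>j. integrable lborel (\<phi> j)"
  shows "(LINT x|(lborel :: (real ^ 'n) measure). (\<Prod>j\<in>UNIV. \<phi> j (x $ j))) = (\<Prod>j\<in>UNIV. LINT t|lborel. \<phi> j t)"
proof -
  interpret product_sigma_finite "\<lambda>_ :: real ^ 'n. lborel :: real measure" ..
  \<comment> \<open>The factors are re-indexed from coordinates to basis vectors,
    \<open>axis_index\<close> sending \<open>axis j 1\<close> back to \<open>j\<close>.\<close>
  let ?\<phi> = "\<lambda>b :: real ^ 'n. \<phi> (axis_index b)"
  let ?P = "Pi\<^sub>M Basis (\<lambda>_ :: real ^ 'n. lborel :: real measure)"
  have [measurable]: "\<phi> j \<in> borel_measurable borel" for j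
    using borel_measurable_integrable[OF int[of j]] by simp
  have [measurable]: "(\<lambda>x :: real ^ 'n. x $ j) \<in> borel_measurable borel" for j
    by (intro borel_measurable_continuous_onI continuous_intros)
  have "(LINT x|(lborel :: (real ^ 'n) measure). (\<Prod>j\<in>UNIV. \<phi> j (x $ j)))
      = (LINT y|?P. (\<Prod>j\<in>UNIV. \<phi> j ((\<Sum>b\<in>Basis. y b *\<^sub>R b) $ j)))"
    by (subst lborel_eq, rule integral_distr) measurable
  also have "\<dots> = (LINT y|?P. (\<Prod>b\<in>Basis. ?\<phi> b (y b)))"
  proof (rule Bochner_Integration.integral_cong[OF refl])
    fix y :: "real ^ 'n \<Rightarrow> real"
    have "(\<Sum>b\<in>Basis. y b *\<^sub>R b) $ j = y (axis j 1)" for j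
    proof -
      have "(\<Sum>b\<in>Basis. y b *\<^sub>R b) \<bullet> axis j 1 = y (axis j 1)"
        by (rule inner_sum_left_Basis) simp
      thus ?thesis by (simp add: inner_axis)
    qed
    thus "(\<Prod>j\<in>UNIV. \<phi> j ((\<Sum>b\<in>Basis. y b *\<^sub>R b) $ j)) = (\<Prod>b\<in>Basis. ?\<phi> b (y b))"
      by (simp add: prod_Basis_vec)
  qed
  also have "\<dots> = (\<Prod>b\<in>Basis. LINT t|lborel. ?\<phi> b t)"
    by (rule product_integral_prod) (auto intro: int)
  finally show ?thesis by (simp add: prod_Basis_vec)
qed

text \<open>Both the cube indicator and the character factor over the coordinates, so the integral
  is a product of circle integrals; a single non-zero frequency makes it vanish.\<close>

lemma LINT_torus_char: "(LINT w|torus_lebesgue. torus_char k w) = (if k = 0 then 1 else 0)"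
proof -
  let ?\<phi> = "\<lambda>j x. indicator {0..<1} x *\<^sub>R exp (- 2 * of_real pi * \<i> * of_real (x * of_int (k $ j))) :: complex"
  have "(LINT w|torus_lebesgue. torus_char k w) =
    (LINT x|lborel. indicator {x. \<forall>i. 0 \<le> x $ i \<and> x $ i < 1} x *\<^sub>R torus_char k (to_torus x))"
    by (rule LINT_torus) measurable
  also have "\<dots> = (LINT x|lborel. (\<Prod>j\<in>UNIV. ?\<phi> j (x $ j)))"
  proof (rule Bochner_Integration.integral_cong[OF refl])
    fix x :: "real ^ 'a"
    have "(indicator {x. \<forall>i. 0 \<le> x $ i \<and> x $ i < 1} x :: real) = (\<Prod>j\<in>UNIV. indicator {0..<1} (x $ j))"
      by (auto simp: indicator_def)
    thus "indicator {x. \<forall>i. 0 \<le> x $ i \<and> x $ i < 1} x *\<^sub>R torus_char k (to_torus x) = (\<Prod>j\<in>UNIV. ?\<phi> j (x $ j))"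
      by (simp only: torus_char_to_torus scaleR_conv_of_real of_real_prod prod.distrib)
  qed
  also have "\<dots> = (\<Prod>j\<in>UNIV. LINT t|lborel. ?\<phi> j t)"
    using has_bochner_integral_circle_char by (intro integral_lborel_prod) (rule has_bochner_integral_iff[THEN iffD1, THEN conjunct1])
  also have "\<dots> = (\<Prod>j\<in>UNIV. if k $ j = 0 then 1 else 0)"
    using has_bochner_integral_circle_char by (intro prod.cong refl) (rule has_bochner_integral_integral_eq)
  also have "\<dots> = (if k = 0 then 1 else 0)"
    by (auto simp: vec_eq_iff)
  finally show ?thesis .
qed

lemma torus_char_0: "torus_char 0 w = 1"
  by transfer simp

lemma finite_measure_torus_lebesgue: "finite_measure (torus_lebesgue :: 'n::finite torus measure)"
proof
  \<comment> \<open>A non-integrable function has Bochner integral 0 by convention. The trivial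
    character has integral 1, hence it is integrable, and so is the constant 1.\<close>
  have "integrable torus_lebesgue (torus_char (0 :: int ^ 'n))"
    using LINT_torus_char[of "0 :: int ^ 'n"] by (metis not_integrable_integral_eq zero_neq_one)
  hence "integrable (torus_lebesgue :: 'n torus measure) (\<lambda>_. 1 :: complex)"
    by (simp only: torus_char_0[abs_def])
  thus "emeasure torus_lebesgue (space (torus_lebesgue :: 'n torus measure)) \<noteq> \<infinity>"
    by (simp add: integrable_iff_bounded)
qed


section \<open>Square-summable and square-integrable functions\<close>

lemma ell2_iff: "f \<in> ell2 \<longleftrightarrow> (\<lambda>k. (cmod (f k))\<^sup>2) summable_on UNIV"
  by (simp add: ell2_def)

lemma ell2_norm_nonneg [simp]: "0 \<le> ell2_norm f"
  by (simp add: ell2_norm_def infsum_nonneg)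

lemma nn_integral_ell2:
  assumes "f \<in> ell2"
  shows "(\<integral>\<^sup>+k. ennreal ((cmod (f k))\<^sup>2) \<partial>count_space UNIV) = ennreal ((ell2_norm f)\<^sup>2)"
proof -
  have "(ell2_norm f)\<^sup>2 = (\<Sum>\<^sub>\<infinity>k. (cmod (f k))\<^sup>2)"
    by (simp add: ell2_norm_def infsum_nonneg)
  thus ?thesis
    using assms by (simp add: nn_integral_count_space_eq_infsum ell2_iff)
qed

lemma ell2_norm_eq_0D:
  assumes "f \<in> ell2" "ell2_norm f = 0"
  shows "f = (\<lambda>_. 0)"
proof
  fix k
  have "(\<Sum>\<^sub>\<infinity>k. (cmod (f k))\<^sup>2) = 0"
    using assms(2) by (simp add: ell2_norm_def)
  hence "(cmod (f k))\<^sup>2 = 0"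
    using assms(1) nonneg_infsum_le_0D[of "\<lambda>k. (cmod (f k))\<^sup>2" UNIV k] by (simp add: ell2_iff)
  thus "f k = 0" by simp
qed

lemma ell2_cmult:
  assumes "f \<in> ell2"
  shows "(\<lambda>k. c * f k) \<in> ell2"
  using assms by (simp add: ell2_iff norm_mult power_mult_distrib summable_on_cmult_right)

lemma ell2_mult_abs_summable:
  assumes "f \<in> ell2" "g \<in> ell2"
  shows "(\<lambda>k. cmod (f k * g k)) summable_on UNIV"
proof (rule abs_summable_product)
  show "(\<lambda>k. norm (f k * f k)) summable_on UNIV" "(\<lambda>k. norm (g k * g k)) summable_on UNIV"
    using assms by (simp_all add: ell2_iff norm_mult power2_eq_square)
qed

lemma ell2_diff:
  assumes "f \<in> ell2" "h \<in> ell2"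
  shows "(\<lambda>k. f k - h k) \<in> ell2"
proof -
  have "(\<lambda>k. 2 * (cmod (f k))\<^sup>2 + 2 * (cmod (h k))\<^sup>2) summable_on UNIV"
    using assms unfolding ell2_iff by (intro summable_on_add summable_on_cmult_right)
  moreover have "norm ((cmod (f k - h k))\<^sup>2) \<le> 2 * (cmod (f k))\<^sup>2 + 2 * (cmod (h k))\<^sup>2" for k
  proof -
    have "(cmod (f k - h k))\<^sup>2 \<le> (cmod (f k) + cmod (h k))\<^sup>2"
      by (intro power_mono norm_triangle_ineq4) simp
    \<comment> \<open>This is the nonnegativity of the square of the difference of the two moduli,
      rearranged.\<close>
    also have "\<dots> \<le> 2 * (cmod (f k))\<^sup>2 + 2 * (cmod (h k))\<^sup>2"
      using zero_le_power2[of "cmod (f k) - cmod (h k)"] by (simp add: power2_sum power2_diff)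
    finally show ?thesis by simp
  qed
  ultimately have "(\<lambda>k. norm ((cmod (f k - h k))\<^sup>2)) summable_on UNIV"
    by (rule Infinite_Sum.abs_summable_on_comparison_test')
  thus ?thesis by (simp add: ell2_iff)
qed

lemma ell2_cnj_translate:
  fixes g :: "'a :: ab_group_add \<Rightarrow> complex"
  assumes "g \<in> ell2"
  shows "(\<lambda>k. cnj (g (k - m))) \<in> ell2"
proof -
  have "bij_betw (\<lambda>k. k - m) UNIV UNIV"
    by (rule bij_betwI[of _ _ _ "\<lambda>k. k + m"]) auto
  from summable_on_reindex_bij_betw[OF this, of "\<lambda>k. (cmod (g k))\<^sup>2"] assms show ?thesis
    by (simp add: ell2_iff)
qed

lemma Lsq_norm_nonneg [simp]: "0 \<le> Lsq_norm M F"
  by (simp add: Lsq_norm_def)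

lemma Lsq_norm_power2: "(Lsq_norm M F)\<^sup>2 = (LINT x|M. (cmod (F x))\<^sup>2)"
  by (simp add: Lsq_norm_def)

lemma Lsq_norm_cmult: "Lsq_norm M (\<lambda>x. c * F x) = cmod c * Lsq_norm M F"
  by (simp add: Lsq_norm_def norm_mult power_mult_distrib real_sqrt_mult)

text \<open>Pointwise the squared modulus splits into its parts on \<open>S\<close> and on
  \<open>- S\<close>. Square-integrability of \<open>F\<close> allows the integral to be split
  accordingly.\<close>

lemma Lsq_norm_restrict_op_split:
  assumes F: "F \<in> Lsq M" and S: "S \<in> sets M"
  shows "(Lsq_norm M (restrict_op S F))\<^sup>2 + (Lsq_norm M (restrict_op (- S) F))\<^sup>2 = (Lsq_norm M F)\<^sup>2"
proof -
  have int: "integrable M (\<lambda>x. (cmod (F x))\<^sup>2)"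
    using F by (simp add: Lsq_def)
  have eq: "(cmod (restrict_op A F x))\<^sup>2 = indicator A x * (cmod (F x))\<^sup>2" for A x
    by (simp add: restrict_op_def indicator_def)
  have 1: "integrable M (\<lambda>x. indicator S x * (cmod (F x))\<^sup>2)"
    using integrable_mult_indicator[OF S int] by simp
  have 2: "indicator (- S) x * (cmod (F x))\<^sup>2 = (cmod (F x))\<^sup>2 - indicator S x * (cmod (F x))\<^sup>2" for x
    by (simp add: indicator_def)
  show ?thesis
    unfolding Lsq_norm_power2 eq 2 using Bochner_Integration.integral_diff[OF int 1] by simp
qed


section \<open>The short-time Fourier transform\<close>

text \<open>Products of square-summable functions are absolutely summable. Hence the series defining
  the transform converges absolutely at every point, and for fixed \<open>m\<close> its coefficients
  satisfy the summability assumption of Parseval's identity.\<close>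

lemma stft_summand_abs_summable:
  fixes f g :: "int ^ 'n::finite \<Rightarrow> complex"
  assumes "f \<in> ell2" "g \<in> ell2"
  shows "(\<lambda>k. cmod (f k * cnj (g (k - m)))) summable_on UNIV"
  using assms by (intro ell2_mult_abs_summable ell2_cnj_translate[where g = g])

lemma stft_summand_summable:
  fixes f g :: "int ^ 'n::finite \<Rightarrow> complex"
  assumes "f \<in> ell2" "g \<in> ell2"
  shows "(\<lambda>k. f k * cnj (g (k - m)) * torus_char k w) summable_on UNIV"
  by (rule abs_summable_summable) (use stft_summand_abs_summable[OF assms, of m] in \<open>simp add: norm_mult\<close>)

lemma stft_diff:
  assumes "f \<in> ell2" "h \<in> ell2" "g \<in> ell2"
  shows "stft g (\<lambda>k. f k - h k) = (\<lambda>x. stft g f x - stft g h x)"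
proof (clarsimp simp: stft_def fun_eq_iff)
  fix m w
  show "(\<Sum>\<^sub>\<infinity>k. (f k - h k) * cnj (g (k - m)) * torus_char k w) =
    (\<Sum>\<^sub>\<infinity>k. f k * cnj (g (k - m)) * torus_char k w) - (\<Sum>\<^sub>\<infinity>k. h k * cnj (g (k - m)) * torus_char k w)"
    using infsum_add[OF stft_summand_summable[OF assms(1,3)], of "\<lambda>k. - (h k * cnj (g (k - m)) * torus_char k w)"]
      stft_summand_summable[OF assms(2,3)]
    by (simp add: infsum_uminus summable_on_uminus left_diff_distrib)
qed

lemma stft_cmult: "stft g (\<lambda>k. c * f k) = (\<lambda>x. c * stft g f x)"
  by (simp add: stft_def fun_eq_iff mult.assoc infsum_cmult_right')

lemma borel_measurable_stft [measurable]:
  assumes "f \<in> ell2" "g \<in> ell2"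
  shows "stft g f \<in> borel_measurable phase_measure"
  unfolding phase_measure_def
proof (rule measurable_pair_measure_countable1)
  fix m
  show "(\<lambda>w. stft g f (m, w)) \<in> borel_measurable torus_lebesgue"
    unfolding stft_def prod.case
    by (rule borel_measurable_infsum[OF finite_measure_torus_lebesgue _ stft_summand_abs_summable[OF assms, of m]])
      (auto simp: norm_mult)
qed simp

lemma nn_integral_stft:
  fixes f g :: "int ^ 'n::finite \<Rightarrow> complex"
  assumes f: "f \<in> ell2" and g: "g \<in> ell2"
  shows "(\<integral>\<^sup>+x. ennreal ((cmod (stft g f x))\<^sup>2) \<partial>phase_measure) = ennreal ((ell2_norm f * ell2_norm g)\<^sup>2)"
proof -
  interpret T: finite_measure "torus_lebesgue :: 'n torus measure"
    by (rule finite_measure_torus_lebesgue)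
  have meas: "(\<lambda>x. ennreal ((cmod (stft g f x))\<^sup>2)) \<in> borel_measurable (count_space UNIV \<Otimes>\<^sub>M torus_lebesgue)"
    using borel_measurable_stft[OF f g] unfolding phase_measure_def by measurable
  \<comment> \<open>For fixed \<open>m\<close> the transform is a character series in
    \<open>w\<close> with coefficients \<open>f k * cnj (g (k - m))\<close>.\<close>
  have fibre: "(\<integral>\<^sup>+w. ennreal ((cmod (stft g f (m, w)))\<^sup>2) \<partial>torus_lebesgue) =
      (\<integral>\<^sup>+k. ennreal ((cmod (f k * cnj (g (k - m))))\<^sup>2) \<partial>count_space UNIV)" for m
    unfolding stft_def prod.case
    by (rule nn_integral_orthonormal_series[OF finite_measure_torus_lebesgue])
      (auto simp: torus_char_mult_cnj LINT_torus_char stft_summand_abs_summable[OF f g])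
  \<comment> \<open>After the sums over \<open>m\<close> and \<open>k\<close> are exchanged, the
    inner sum runs over \<open>m\<close>. The map sending \<open>m\<close> to \<open>k - m\<close>
    is its own inverse, so that sum is the full squared norm of \<open>g\<close>.\<close>
  have shift: "(\<integral>\<^sup>+m. ennreal ((cmod (g (k - m)))\<^sup>2) \<partial>count_space UNIV) = ennreal ((ell2_norm g)\<^sup>2)" for k
  proof -
    have "bij_betw (\<lambda>m. k - m) UNIV UNIV"
      by (rule bij_betwI[of _ _ _ "\<lambda>m. k - m"]) auto
    from nn_integral_bij_count_space[OF this, of "\<lambda>m. ennreal ((cmod (g m))\<^sup>2)"] show ?thesis
      by (simp add: nn_integral_ell2[OF g])
  qed
  have "(\<integral>\<^sup>+x. ennreal ((cmod (stft g f x))\<^sup>2) \<partial>phase_measure) =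
      (\<integral>\<^sup>+m. \<integral>\<^sup>+w. ennreal ((cmod (stft g f (m, w)))\<^sup>2) \<partial>torus_lebesgue \<partial>count_space UNIV)"
    unfolding phase_measure_def by (rule T.nn_integral_fst[OF meas, symmetric])
  also have "\<dots> = (\<integral>\<^sup>+m. \<integral>\<^sup>+k. ennreal ((cmod (f k * cnj (g (k - m))))\<^sup>2) \<partial>count_space UNIV \<partial>count_space UNIV)"
    by (simp add: fibre)
  also have "\<dots> = (\<integral>\<^sup>+k. \<integral>\<^sup>+m. ennreal ((cmod (f k * cnj (g (k - m))))\<^sup>2) \<partial>count_space UNIV \<partial>count_space UNIV)"
    by (rule nn_integral_count_space_nn_integral) auto
  also have "\<dots> = (\<integral>\<^sup>+k. ennreal ((cmod (f k))\<^sup>2) * ennreal ((ell2_norm g)\<^sup>2) \<partial>count_space UNIV)"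
    by (simp add: norm_mult power_mult_distrib ennreal_mult nn_integral_cmult shift)
  also have "\<dots> = ennreal ((ell2_norm f)\<^sup>2) * ennreal ((ell2_norm g)\<^sup>2)"
    by (simp add: nn_integral_multc nn_integral_ell2[OF f])
  finally show ?thesis
    by (simp add: power_mult_distrib ennreal_mult)
qed

lemma
  assumes "f \<in> ell2" "g \<in> ell2"
  shows stft_in_Lsq: "stft g f \<in> Lsq phase_measure"
    and Lsq_norm_stft: "Lsq_norm phase_measure (stft g f) = ell2_norm f * ell2_norm g"
proof -
  note [measurable] = borel_measurable_stft[OF assms]
  have "has_bochner_integral phase_measure (\<lambda>x. (cmod (stft g f x))\<^sup>2) ((ell2_norm f * ell2_norm g)\<^sup>2)"
    by (rule has_bochner_integral_nn_integral) (auto simp: nn_integral_stft[OF assms])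
  thus "stft g f \<in> Lsq phase_measure" "Lsq_norm phase_measure (stft g f) = ell2_norm f * ell2_norm g"
    by (auto simp: Lsq_def Lsq_norm_def has_bochner_integral_iff)
qed

text \<open>\<open>orth_proj\<close> chooses some representative, so equality as functions requires
  uniqueness inside the range. A second candidate \<open>stft g h\<close> differs from
  \<open>stft g f\<close> by an element of the range orthogonal to itself. That element has norm
  zero, and since \<open>g\<close> is non-zero, injectivity gives \<open>f = h\<close>, not merely
  equality almost everywhere.\<close>

lemma stft_proj_stft:
  assumes f: "f \<in> ell2" and g: "g \<in> ell2" and g0: "g \<noteq> (\<lambda>_. 0)"
  shows "stft_proj g (stft g f) = stft g f"
  unfolding stft_proj_def orth_proj_def
proof (rule some_equality)
  fix H
  assume H: "H \<in> stft g ` ell2 \<and>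
    (\<forall>G\<in>stft g ` ell2. Lsq_inner phase_measure (\<lambda>x. stft g f x - H x) G = 0)"
  then obtain h where h: "h \<in> ell2" "H = stft g h" by auto
  define d where "d k = f k - h k" for k
  have d: "d \<in> ell2"
    unfolding d_def using f h(1) by (rule ell2_diff)
  \<comment> \<open>The difference \<open>stft g d\<close> is itself in the range and serves as the
    test element \<open>G\<close>.\<close>
  have "Lsq_inner phase_measure (stft g d) (stft g d) = 0"
    using H d stft_diff[OF f h(1) g] h(2) by (auto simp: d_def[abs_def])
  moreover have "Lsq_inner phase_measure (stft g d) (stft g d) = of_real ((Lsq_norm phase_measure (stft g d))\<^sup>2)"
    by (simp add: Lsq_inner_def Lsq_norm_power2 complex_norm_square flip: integral_complex_of_real of_real_power)
  ultimately have "ell2_norm d * ell2_norm g = 0"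
    using Lsq_norm_stft[OF d g] by simp
  moreover have "ell2_norm g \<noteq> 0"
    using ell2_norm_eq_0D[OF g] g0 by auto
  ultimately have "d = (\<lambda>_. 0)"
    using ell2_norm_eq_0D[OF d] by simp
  hence "f = h"
    by (auto simp: d_def fun_eq_iff)
  thus "H = stft g f" by (simp add: h(2))
qed (use f in \<open>auto simp: Lsq_inner_def\<close>)

section \<open>From the operator norm to the lower bound on the complement\<close>

theorem proposition3p12:
  fixes g :: "int ^ 'n \<Rightarrow> complex"
    and \<Sigma> :: "((int ^ 'n) \<times> ('n :: finite) torus) set"
  assumes "g \<in> ell2"
    and "g \<noteq> (\<lambda>_. 0)"
    and "\<Sigma> \<in> sets phase_measure"
    and "Lsq_opnorm phase_measure (restrict_op \<Sigma> \<circ> stft_proj g) < 1"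
  shows "\<exists>c > 0. \<forall>f \<in> ell2.
    ell2_norm f * ell2_norm g \<le> c * Lsq_norm phase_measure (restrict_op (- \<Sigma>) (stft g f))"
proof -
  let ?N = "Lsq_norm phase_measure" and ?T = "restrict_op \<Sigma> \<circ> stft_proj g"
  \<comment> \<open>A norm below 1 is finite, so passing to the real number \<open>r\<close> loses
    nothing.\<close>
  define r where "r = enn2real (Lsq_opnorm phase_measure ?T)"
  have r_eq: "ennreal r = Lsq_opnorm phase_measure ?T"
    using assms(4) unfolding r_def by (intro ennreal_enn2real) (auto intro: less_trans)
  have r: "0 \<le> r" "r < 1"
    using assms(4) unfolding r_eq[symmetric] by (auto simp: r_def)
  hence r2: "r\<^sup>2 < 1"
    by (simp add: power_less_one_iff abs_square_less_1)
  \<comment> \<open>The operator norm is a supremum over the unit ball, so the estimate is first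
    proved for transforms of norm 1.\<close>
  have unit: "sqrt (1 - r\<^sup>2) \<le> ?N (restrict_op (- \<Sigma>) (stft g f))"
    if f: "f \<in> ell2" and f1: "ell2_norm f * ell2_norm g = 1" for f
  proof -
    have N1: "?N (stft g f) = 1"
      using Lsq_norm_stft[OF f assms(1)] f1 by simp
    \<comment> \<open>\<open>stft g f\<close> is a competitor in the supremum; because the
      projection fixes it, this bounds the mass of the transform on \<open>\<Sigma>\<close>.\<close>
    have "ennreal (?N (?T (stft g f))) \<le> ennreal r"
      unfolding r_eq Lsq_opnorm_def using stft_in_Lsq[OF f assms(1)] N1 by (intro SUP_upper) simp
    hence "?N (restrict_op \<Sigma> (stft g f)) \<le> r"
      using r(1) by (simp add: stft_proj_stft[OF f assms(1,2)])
    hence "(?N (restrict_op \<Sigma> (stft g f)))\<^sup>2 \<le> r\<^sup>2"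
      by (intro power_mono) auto
    hence "1 - r\<^sup>2 \<le> (?N (restrict_op (- \<Sigma>) (stft g f)))\<^sup>2"
      using Lsq_norm_restrict_op_split[OF stft_in_Lsq[OF f assms(1)] assms(3)] N1 by simp
    thus ?thesis
      by (intro real_le_lsqrt) auto
  qed
  show ?thesis
  \<comment> \<open>The constant is the reciprocal of the lower bound in \<open>unit\<close>; it is
    positive because \<open>r < 1\<close>.\<close>
  proof (intro exI[of _ "1 / sqrt (1 - r\<^sup>2)"] conjI ballI)
    show "0 < 1 / sqrt (1 - r\<^sup>2)" using r2 by simp
    fix f :: "int ^ 'n \<Rightarrow> complex" assume f: "f \<in> ell2"
    define a where "a = ell2_norm f * ell2_norm g"
    show "ell2_norm f * ell2_norm g \<le> 1 / sqrt (1 - r\<^sup>2) * ?N (restrict_op (- \<Sigma>) (stft g f))"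
    \<comment> \<open>If \<open>a = 0\<close> the left-hand side vanishes. Otherwise dividing
      \<open>f\<close> by \<open>a\<close>, the norm of its transform, reduces to
      \<open>unit\<close>, and homogeneity scales the estimate back.\<close>
    proof (cases "a = 0")
      case True
      thus ?thesis
        using r2 unfolding a_def[symmetric] by simp
    next
      case False
      hence a: "a > 0" by (simp add: a_def order_less_le)
      define f' where "f' k = complex_of_real (1 / a) * f k" for k
      have f': "f' \<in> ell2"
        unfolding f'_def using f by (rule ell2_cmult)
      have scale: "stft g f' = (\<lambda>x. complex_of_real (1 / a) * stft g f x)"
        unfolding f'_def by (rule stft_cmult)
      have "ell2_norm f' * ell2_norm g = (1 / a) * ?N (stft g f)"
        using Lsq_norm_stft[OF f' assms(1)] a unfolding scale Lsq_norm_cmult by (simp add: norm_divide)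
      hence "ell2_norm f' * ell2_norm g = 1"
        using Lsq_norm_stft[OF f assms(1)] a by (simp flip: a_def)
      from unit[OF f' this] have "sqrt (1 - r\<^sup>2) \<le> ?N (\<lambda>x. complex_of_real (1 / a) * restrict_op (- \<Sigma>) (stft g f) x)"
        by (simp add: scale restrict_op_def mult_ac)
      hence "sqrt (1 - r\<^sup>2) \<le> (1 / a) * ?N (restrict_op (- \<Sigma>) (stft g f))"
        using a unfolding Lsq_norm_cmult by (simp add: norm_divide)
      thus ?thesis
        using a r2 by (simp add: field_simps flip: a_def)
    qed
  qed
qed

end
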